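(* Let $\mathbb{G}=(\mathbb{V},\mathbb{E})$ be a connected, locally finite, vertex-transitive and countably infinite graph, and consider Bernoulli bond percolation on $\mathbb{G}$. For every $p\in[0,1]$ with $p\ge p_c$, \[ \mathbb{P}_p\big[|\mathcal{C}_o|=+\infty\big]\ge \frac{p-p_c}{p}. \]
   Context: Locally finite means that every vertex has finite degree; vertex-transitive means that for all vertices $v,w$ there is an automorphism of $\mathbb{G}$ mapping $v$ to $w$. Bernoulli bond percolation of parameter $p\in[0,1]$: each edge is open (value $1$) with probability $p$ and closed (value $0$) otherwise, independently of the other edges; $\mathbb{P}_p$ is the corresponding product probability measure on $\{0,1\}^{\mathbb{E}}$. A vertex $o\in\mathbb{V}$ is fixed once and for all. $\mathcal{C}_o$ is the cluster of $o$, i.e. the set of all vertices connected to $o$ by a path of open edges (including $o$ itself), and $|\mathcal{C}_o|$ is its cardinality. The critical probability is \[ p_c = \inf\big\{p\in[0,1] : \mathbb{P}_p[|\mathcal{C}_o|=+\infty]>0\big\}. \] *)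

theory Defs
  imports "HOL-Probability.Probability"
begin

text \<open>Simple undirected graphs: a vertex set \<open>V\<close> and a set \<open>E\<close> of unordered pairs of distinct vertices.\<close>

definition simple_graph :: "'a set \<Rightarrow> 'a set set \<Rightarrow> bool" where
  "simple_graph V E \<longleftrightarrow> (\<forall>e\<in>E. \<exists>u\<in>V. \<exists>v\<in>V. u \<noteq> v \<and> e = {u, v})"

definition adj_rel :: "'a set set \<Rightarrow> 'a rel" where
  "adj_rel F = {(u, v). {u, v} \<in> F}"

text \<open>Joined by a finite, possibly empty, path all of whose edges lie in \<open>F\<close>.\<close>

definition joined_by :: "'a set set \<Rightarrow> 'a \<Rightarrow> 'a \<Rightarrow> bool" where
  "joined_by F u v \<longleftrightarrow> (u, v) \<in> (adj_rel F)\<^sup>*"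

definition connected_graph :: "'a set \<Rightarrow> 'a set set \<Rightarrow> bool" where
  "connected_graph V E \<longleftrightarrow> (\<forall>u\<in>V. \<forall>v\<in>V. joined_by E u v)"

definition locally_finite_graph :: "'a set \<Rightarrow> 'a set set \<Rightarrow> bool" where
  "locally_finite_graph V E \<longleftrightarrow> (\<forall>v\<in>V. finite {e \<in> E. v \<in> e})"

definition graph_automorphism :: "'a set \<Rightarrow> 'a set set \<Rightarrow> ('a \<Rightarrow> 'a) \<Rightarrow> bool" where
  "graph_automorphism V E f \<longleftrightarrow>
     bij_betw f V V \<and> (\<forall>u\<in>V. \<forall>v\<in>V. {u, v} \<in> E \<longleftrightarrow> {f u, f v} \<in> E)"

definition vertex_transitive :: "'a set \<Rightarrow> 'a set set \<Rightarrow> bool" where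
  "vertex_transitive V E \<longleftrightarrow>
     (\<forall>v\<in>V. \<forall>w\<in>V. \<exists>f. graph_automorphism V E f \<and> f v = w)"

text \<open>Configurations are functions in \<open>E \<rightarrow>\<^sub>E UNIV\<close>, with \<open>True\<close> for an open edge (value 1)
  and \<open>False\<close> for a closed one (value 0).\<close>

definition bond_percolation :: "'a set set \<Rightarrow> real \<Rightarrow> ('a set \<Rightarrow> bool) measure" where
  "bond_percolation E p = PiM E (\<lambda>_. measure_pmf (bernoulli_pmf p))"

definition open_edges :: "'a set set \<Rightarrow> ('a set \<Rightarrow> bool) \<Rightarrow> 'a set set" where
  "open_edges E \<omega> = {e \<in> E. \<omega> e}"

definition cluster :: "'a set set \<Rightarrow> ('a set \<Rightarrow> bool) \<Rightarrow> 'a \<Rightarrow> 'a set" where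
  "cluster E \<omega> v = {w. joined_by (open_edges E \<omega>) v w}"

definition percolation_prob :: "'a set set \<Rightarrow> 'a \<Rightarrow> real \<Rightarrow> real" where
  "percolation_prob E v p =
     measure (bond_percolation E p)
       {\<omega> \<in> space (bond_percolation E p). infinite (cluster E \<omega> v)}"

definition critical_prob :: "'a set set \<Rightarrow> 'a \<Rightarrow> real" where
  "critical_prob E v = Inf {p \<in> {0..1}. percolation_prob E v p > 0}"

end

theory Submission
  imports Defs
begin

text \<open>
  Write \<open>\<theta>(p)\<close> for the percolation probability. For \<open>p > 0\<close>, the claimed bound says
  \<open>p (1 - \<theta>(p)) \<le> p\<^sub>c\<close>, and this follows from the statement that if \<open>\<theta>(p) < 1\<close>, then
  \<open>\<theta>(q) = 0\<close> for every \<open>q \<le> p (1 - \<theta>(p))\<close> (lemma \<open>percolation_prob_eq_0\<close>).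

  That statement holds because, under the measure of parameter \<open>p\<close> \<^emph>\<open>conditioned on the cluster of\<close>
  \<open>v\<^sub>0\<close> \<^emph>\<open>being finite\<close>, this cluster still stochastically dominates the cluster of \<open>v\<^sub>0\<close> in percolation
  of parameter \<open>q\<close>; hence the latter is almost surely finite. To see the domination, explore the
  cluster edge by edge. Suppose that the vertices of \<open>C\<close> have been reached, that \<open>H\<close> is the set of
  edges not yet revealed, and that the next edge leads from \<open>C\<close> to \<open>y\<close>. Let \<open>h\<close> be the probability
  that what is reached from \<open>C\<close> inside \<open>H\<close> is finite, and let \<open>h1\<close> and \<open>h0\<close> be its values after the
  edge has been found open or closed, so that \<open>h = p h1 + (1 - p) h0\<close>. The edge is open with
  conditional probability \<open>p h1 / h\<close>. Adding \<open>y\<close> to the explored set costs at most a factor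
  \<open>1 - \<theta>(p)\<close>, that is \<open>h1 \<ge> (1 - \<theta>(p)) h0\<close> (lemma \<open>prob_finite_insert_ge\<close>), and \<open>h \<le> h0\<close>, so this
  conditional probability is at least \<open>p (1 - \<theta>(p)) \<ge> q\<close>.

  All statements about the exploration are inductions on pairs \<open>(C, H)\<close> which stop as soon as \<open>C\<close>
  has \<open>n\<close> vertices (rule \<open>exploration_induct\<close>); then \<open>n\<close> tends to infinity. No coupling is
  constructed: each induction step conditions on the state of one edge (lemma \<open>prob_reveal_edge\<close>)
  and compares real numbers. The inequality for \<open>h1\<close>, usually obtained from positive association,
  and the independence of \<open>\<theta>\<close> from the base vertex are proved by the same induction.
\<close>

section \<open>Revealing one edge\<close>

lemma prob_space_bond_percolation: "prob_space (bond_percolation E p)"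
  unfolding bond_percolation_def by (intro prob_space_PiM prob_space_measure_pmf)

lemma space_bond_percolation: "space (bond_percolation E p) = E \<rightarrow>\<^sub>E UNIV"
  by (simp add: bond_percolation_def space_PiM)

lemma measurable_edge_state:
  assumes "e \<in> E"
  shows "Measurable.pred (bond_percolation E p) (\<lambda>\<omega>. \<omega> e)"
proof -
  have "(\<lambda>\<omega>. \<omega> e) \<in> measurable (bond_percolation E p) (measure_pmf (bernoulli_pmf p))"
    unfolding bond_percolation_def using assms by (rule measurable_component_singleton)
  then show ?thesis by (simp cong: measurable_cong_sets)
qed

text \<open>Fubini: the configuration is a pair of the state of \<open>e\<close> and an independent configuration on the
  other edges.\<close>

lemma prob_split_edge:
  assumes e: "e \<in> E" and p: "p \<in> {0..1}"
    and P: "Measurable.pred (bond_percolation E p) P"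
  defines "N \<equiv> bond_percolation (E - {e}) p"
  shows "\<P>(\<omega> in bond_percolation E p. P \<omega>) =
    p * \<P>(\<omega> in N. P (fun_upd \<omega> e True)) + (1 - p) * \<P>(\<omega> in N. P (fun_upd \<omega> e False))"
proof -
  let ?B = "measure_pmf (bernoulli_pmf p)"
  let ?M = "bond_percolation E p"
  let ?f = "\<lambda>(x, X). X(e := x)"
  let ?A = "{\<omega> \<in> space ?M. P \<omega>}"
  interpret N: prob_space N unfolding N_def by (rule prob_space_bond_percolation)
  interpret M: prob_space ?M by (rule prob_space_bond_percolation)
  have ins: "insert e (E - {e}) = E" using e by auto
  have distr: "distr (?B \<Otimes>\<^sub>M N) ?M ?f = ?M"
    using distr_pair_PiM_eq_PiM[of "E - {e}" "\<lambda>_. ?B" e]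
    unfolding N_def bond_percolation_def ins by (simp add: prob_space_measure_pmf)
  have f: "?f \<in> measurable (?B \<Otimes>\<^sub>M N) ?M"
  proof -
    have "?f \<in> measurable (?B \<Otimes>\<^sub>M N) (PiM (insert e (E - {e})) (\<lambda>_. ?B))"
      unfolding N_def bond_percolation_def case_prod_beta
      by (rule measurable_fun_upd[where J = "E - {e}"]) auto
    then show ?thesis unfolding ins by (simp add: bond_percolation_def)
  qed
  have A: "?A \<in> sets ?M" using P by (simp add: pred_def)
  have slice: "Pair x -` (?f -` ?A \<inter> space (?B \<Otimes>\<^sub>M N)) = {\<omega> \<in> space N. P (fun_upd \<omega> e x)}" for x
    using e by (auto simp: space_pair_measure N_def space_bond_percolation PiE_def extensional_def)
  have "emeasure ?M ?A = emeasure (?B \<Otimes>\<^sub>M N) (?f -` ?A \<inter> space (?B \<Otimes>\<^sub>M N))"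
    by (subst distr[symmetric]) (rule emeasure_distr[OF f A])
  also have "\<dots> = (\<integral>\<^sup>+x. emeasure N {\<omega> \<in> space N. P (fun_upd \<omega> e x)} \<partial>?B)"
    by (subst N.emeasure_pair_measure_alt) (use measurable_sets[OF f A] slice in auto)
  also have "\<dots> = ennreal (p * \<P>(\<omega> in N. P (fun_upd \<omega> e True)) + (1 - p) * \<P>(\<omega> in N. P (fun_upd \<omega> e False)))"
    using p by (simp add: N.emeasure_eq_measure mult.commute flip: ennreal_mult ennreal_plus)
  finally show ?thesis
    using p unfolding M.emeasure_eq_measure by (subst (asm) ennreal_inj) auto
qed

text \<open>One step of an exploration: once the state of \<open>e\<close> is known, the event \<open>P\<close> turns into an event
  about the other edges only, whose probability is the same under the full product measure.\<close>

lemma prob_reveal_edge: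
  assumes e: "e \<in> E" and p: "p \<in> {0..1}"
    and meas: "Measurable.pred (bond_percolation E p) P"
      "Measurable.pred (bond_percolation E p) P1" "Measurable.pred (bond_percolation E p) P0"
    and "open": "\<And>\<omega>. \<omega> e \<Longrightarrow> P \<omega> = P1 \<omega>" and closed: "\<And>\<omega>. \<not> \<omega> e \<Longrightarrow> P \<omega> = P0 \<omega>"
    and blind: "\<And>\<omega> b. P1 (fun_upd \<omega> e b) = P1 \<omega>" "\<And>\<omega> b. P0 (fun_upd \<omega> e b) = P0 \<omega>"
  shows "\<P>(\<omega> in bond_percolation E p. P \<omega>) =
    p * \<P>(\<omega> in bond_percolation E p. P1 \<omega>) + (1 - p) * \<P>(\<omega> in bond_percolation E p. P0 \<omega>)"
proof -
  have "P (fun_upd \<omega> e True) = P1 \<omega>" "P (fun_upd \<omega> e False) = P0 \<omega>" for \<omega>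
    by (simp_all add: "open" closed blind)
  then show ?thesis
    by (simp add: prob_split_edge[OF e p meas(1)] prob_split_edge[OF e p meas(2)]
        prob_split_edge[OF e p meas(3)] blind algebra_simps)
qed

section \<open>Reached sets\<close>

text \<open>\<open>H\<close> plays the part of the set of edges not yet revealed and \<open>C\<close> that of the explored vertices.
  The configuration lives on the whole graph throughout, so that the events for different \<open>H\<close>
  belong to one probability space.\<close>

definition reach :: "'a set set \<Rightarrow> 'a set \<Rightarrow> ('a set \<Rightarrow> bool) \<Rightarrow> 'a set" where
  "reach H C \<omega> = (adj_rel (open_edges H \<omega>))\<^sup>* `` C"

definition size_below :: "nat \<Rightarrow> 'a set \<Rightarrow> bool" where
  "size_below n A \<longleftrightarrow> finite A \<and> card A < n"

lemma cluster_eq_reach: "cluster E \<omega> v = reach E {v} \<omega>"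
  by (auto simp: cluster_def reach_def joined_by_def)

lemma reach_superset: "C \<subseteq> reach H C \<omega>"
  by (auto simp: reach_def)

lemma reach_step: "u \<in> reach H C \<omega> \<Longrightarrow> {u, v} \<in> H \<Longrightarrow> \<omega> {u, v} \<Longrightarrow> v \<in> reach H C \<omega>"
  by (auto simp: reach_def adj_rel_def open_edges_def intro: rtrancl_into_rtrancl)

lemma reach_least:
  assumes "C \<subseteq> A" "\<And>u v. u \<in> A \<Longrightarrow> {u, v} \<in> H \<Longrightarrow> \<omega> {u, v} \<Longrightarrow> v \<in> A"
  shows "reach H C \<omega> \<subseteq> A"
proof -
  have "v \<in> A" if "(u, v) \<in> (adj_rel (open_edges H \<omega>))\<^sup>*" "u \<in> A" for u v
    using that by induction (use assms(2) in \<open>auto simp: adj_rel_def open_edges_def\<close>)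
  then show ?thesis using assms(1) by (auto simp: reach_def)
qed

lemma reach_mono:
  assumes "H \<subseteq> H'" "C \<subseteq> C'"
  shows "reach H C \<omega> \<subseteq> reach H' C' \<omega>"
proof (rule reach_least)
  show "C \<subseteq> reach H' C' \<omega>" using assms(2) reach_superset by (rule subset_trans)
  show "v \<in> reach H' C' \<omega>" if "u \<in> reach H' C' \<omega>" "{u, v} \<in> H" "\<omega> {u, v}" for u v
    using that assms(1) reach_step[of u H' C' \<omega> v] by blast
qed

lemma reach_Un: "reach H (C \<union> D) \<omega> = reach H C \<omega> \<union> reach H D \<omega>"
  by (auto simp: reach_def)

lemma reach_closed_edge:
  assumes "\<not> \<omega> e"
  shows "reach H C \<omega> = reach (H - {e}) C \<omega>"
proof -
  have "open_edges H \<omega> = open_edges (H - {e}) \<omega>"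
    using assms by (auto simp: open_edges_def)
  then show ?thesis by (simp add: reach_def)
qed

text \<open>After \<open>{x, y}\<close> has been used to reach \<open>y\<close>, both its ends are in the explored set, and the edge
  has nothing more to contribute.\<close>

lemma reach_open_edge:
  assumes "\<omega> {x, y}" "{x, y} \<in> H" "x \<in> C"
  shows "reach H C \<omega> = reach (H - {{x, y}}) (insert y C) \<omega>" (is "?L = ?R")
proof
  have R: "C \<subseteq> ?R" "y \<in> ?R"
    using reach_superset[of "insert y C"] by auto
  show "?L \<subseteq> ?R"
  proof (rule reach_least[OF R(1)])
    fix u v assume uv: "u \<in> ?R" "{u, v} \<in> H" "\<omega> {u, v}"
    show "v \<in> ?R"
    proof (cases "{u, v} = {x, y}")
      case True
      then show ?thesis using R assms(3) by (auto simp: doubleton_eq_iff)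
    next
      case False
      then show ?thesis using uv by (auto intro: reach_step[OF uv(1)])
    qed
  qed
  have "x \<in> ?L" using assms(3) reach_superset by (rule subsetD[rotated])
  then have "y \<in> ?L" by (rule reach_step) (use assms in simp_all)
  show "?R \<subseteq> ?L"
  proof (rule reach_least)
    show "insert y C \<subseteq> ?L" using \<open>y \<in> ?L\<close> reach_superset by (rule insert_subsetI)
    show "v \<in> ?L" if "u \<in> ?L" "{u, v} \<in> H - {{x, y}}" "\<omega> {u, v}" for u v
      by (rule reach_step[OF that(1)]) (use that in simp_all)
  qed
qed

lemma reach_blind: "e \<notin> H \<Longrightarrow> reach H C (fun_upd \<omega> e b) = reach H C \<omega>"
  unfolding reach_def open_edges_def by (rule arg_cong[where f = "\<lambda>F. (adj_rel F)\<^sup>* `` C"]) auto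

definition edge_boundary :: "'a set set \<Rightarrow> 'a set \<Rightarrow> 'a set set" where
  "edge_boundary H C = {e \<in> H. \<exists>x\<in>C. \<exists>y. y \<notin> C \<and> e = {x, y}}"

lemma reach_isolated: "edge_boundary H C = {} \<Longrightarrow> reach H C \<omega> = C"
  by (intro equalityI reach_superset reach_least) (auto simp: edge_boundary_def)

lemma size_below_reach_imp: "size_below n (reach H C \<omega>) \<Longrightarrow> card C < n"
  using reach_superset[of C H \<omega>] card_mono[of "reach H C \<omega>" C] by (auto simp: size_below_def)

section \<open>Exploration of clusters\<close>

locale percolation_graph =
  fixes V :: "'a set" and E :: "'a set set"
  assumes simple: "simple_graph V E"
    and locally_finite: "locally_finite_graph V E"
    and countable_V: "countable V"
begin

lemma edge_in_V: "{x, y} \<in> E \<Longrightarrow> x \<in> V \<and> y \<in> V"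
  using simple unfolding simple_graph_def by (fastforce simp: doubleton_eq_iff)

lemma countable_E: "countable E"
proof (rule countable_subset)
  show "E \<subseteq> {A. finite A \<and> A \<subseteq> V}" using simple by (auto simp: simple_graph_def)
qed (rule countable_Collect_finite_subset[OF countable_V])

lemma reach_subset_V: "C \<subseteq> V \<Longrightarrow> H \<subseteq> E \<Longrightarrow> reach H C \<omega> \<subseteq> V"
  by (rule reach_least) (use edge_in_V in auto)

text \<open>Being reached in \<open>n\<close> steps is measurable by induction on \<open>n\<close>: the last intermediate vertex ranges
  over a countable set.\<close>

lemma measurable_mem_reach:
  assumes "C \<subseteq> V" "H \<subseteq> E"
  shows "Measurable.pred (bond_percolation E p) (\<lambda>\<omega>. w \<in> reach H C \<omega>)"
proof -
  let ?M = "bond_percolation E p"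
  let ?R = "\<lambda>\<omega>. adj_rel (open_edges H \<omega>)"
  have open_edge: "Measurable.pred ?M (\<lambda>\<omega>. e \<in> H \<and> \<omega> e)" for e
    using assms(2) measurable_edge_state[of e E p] by (cases "e \<in> H") auto
  have layer: "Measurable.pred ?M (\<lambda>\<omega>. w \<in> (?R \<omega> ^^ n) `` C)" for n w
  proof (induction n arbitrary: w)
    case 0
    then show ?case by simp
  next
    case (Suc n)
    have sub: "(?R \<omega> ^^ n) `` C \<subseteq> V" for \<omega>
      using reach_subset_V[OF assms, of \<omega>] relpow_imp_rtrancl[of _ n "?R \<omega>"]
      by (fastforce simp: reach_def)
    have "w \<in> (?R \<omega> ^^ Suc n) `` C \<longleftrightarrow> (\<exists>z\<in>V. z \<in> (?R \<omega> ^^ n) `` C \<and> {z, w} \<in> H \<and> \<omega> {z, w})" for \<omega>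
      using sub[of \<omega>] by (fastforce simp: adj_rel_def open_edges_def)
    moreover have "Measurable.pred ?M (\<lambda>\<omega>. \<exists>z\<in>V. z \<in> (?R \<omega> ^^ n) `` C \<and> {z, w} \<in> H \<and> \<omega> {z, w})"
      unfolding pred_def
      by (intro sets.sets_Collect_countable_Ex' countable_V sets.sets_Collect_conj(1)
          Suc[unfolded pred_def] open_edge[unfolded pred_def])
    ultimately show ?case by simp
  qed
  have "w \<in> reach H C \<omega> \<longleftrightarrow> (\<exists>n. w \<in> (?R \<omega> ^^ n) `` C)" for \<omega>
    unfolding reach_def rtrancl_is_UN_relpow by blast
  then show ?thesis using layer by simp
qed

lemma measurable_size_below:
  assumes "C \<subseteq> V" "H \<subseteq> E"
  shows "Measurable.pred (bond_percolation E p) (\<lambda>\<omega>. size_below n (reach H C \<omega>))"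
proof -
  let ?F = "{F. finite F \<and> F \<subseteq> V} \<inter> {F. card F < n}"
  have "size_below n (reach H C \<omega>) \<longleftrightarrow> (\<exists>F\<in>?F. \<forall>w\<in>V - F. \<not> w \<in> reach H C \<omega>)" for \<omega>
  proof
    assume "size_below n (reach H C \<omega>)"
    then show "\<exists>F\<in>?F. \<forall>w\<in>V - F. \<not> w \<in> reach H C \<omega>"
      using reach_subset_V[OF assms, of \<omega>]
      by (intro bexI[of _ "reach H C \<omega>"]) (auto simp: size_below_def)
  next
    assume "\<exists>F\<in>?F. \<forall>w\<in>V - F. \<not> w \<in> reach H C \<omega>"
    then obtain F where F: "finite F" "card F < n" "reach H C \<omega> \<subseteq> F"
      using reach_subset_V[OF assms, of \<omega>] by auto
    then show "size_below n (reach H C \<omega>)"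
      using card_mono[OF F(1,3)] finite_subset[OF F(3,1)] by (simp add: size_below_def)
  qed
  moreover have "Measurable.pred (bond_percolation E p)
      (\<lambda>\<omega>. \<exists>F\<in>?F. \<forall>w\<in>V - F. \<not> w \<in> reach H C \<omega>)"
    unfolding pred_def
    by (intro sets.sets_Collect_countable_Ex' sets.sets_Collect_countable_All' sets.sets_Collect_neg
        countable_Diff countable_Int1 countable_V countable_Collect_finite_subset)
      (use measurable_mem_reach[OF assms] in \<open>auto simp: pred_def\<close>)
  ultimately show ?thesis by simp
qed

lemma measurable_finite_reach:
  assumes "C \<subseteq> V" "H \<subseteq> E"
  shows "Measurable.pred (bond_percolation E p) (\<lambda>\<omega>. finite (reach H C \<omega>))"
proof -
  have "finite A \<longleftrightarrow> (\<exists>n. size_below n A)" for A :: "'a set"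
    by (auto simp: size_below_def)
  then show ?thesis using measurable_size_below[OF assms] by simp
qed

lemma prob_size_below_tendsto:
  assumes "C \<subseteq> V" "H \<subseteq> E"
  shows "(\<lambda>n. \<P>(\<omega> in bond_percolation E p. size_below n (reach H C \<omega>)))
    \<longlonglongrightarrow> \<P>(\<omega> in bond_percolation E p. finite (reach H C \<omega>))"
proof -
  let ?M = "bond_percolation E p"
  interpret prob_space ?M by (rule prob_space_bond_percolation)
  let ?A = "\<lambda>n. {\<omega> \<in> space ?M. size_below n (reach H C \<omega>)}"
  have "(\<lambda>n. prob (?A n)) \<longlonglongrightarrow> prob (\<Union>n. ?A n)"
    using measurable_size_below[OF assms, where p = p]
    by (intro finite_Lim_measure_incseq) (auto simp: pred_def incseq_def size_below_def)
  also have "(\<Union>n. ?A n) = {\<omega> \<in> space ?M. finite (reach H C \<omega>)}"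
    by (auto simp: size_below_def)
  finally show ?thesis .
qed

text \<open>Revealing an open boundary edge makes \<open>C\<close> larger, and revealing a closed one makes its boundary,
  which is finite by local finiteness, smaller. So the exploration ends with \<open>n\<close> vertices or
  without boundary, and a property of \<open>(C, H)\<close> may be assumed for the two outcomes of the next
  step.\<close>

lemma exploration_induct [consumes 3, case_names big isolated reveal]:
  assumes "finite C" "C \<subseteq> V" "H \<subseteq> E"
    and big: "\<And>C H. finite C \<Longrightarrow> C \<subseteq> V \<Longrightarrow> H \<subseteq> E \<Longrightarrow> n \<le> card C \<Longrightarrow> Q C H"
    and isolated: "\<And>C H. finite C \<Longrightarrow> C \<subseteq> V \<Longrightarrow> H \<subseteq> E \<Longrightarrow> card C < n \<Longrightarrow>
      edge_boundary H C = {} \<Longrightarrow> Q C H"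
    and reveal: "\<And>C H x y. finite C \<Longrightarrow> C \<subseteq> V \<Longrightarrow> H \<subseteq> E \<Longrightarrow> x \<in> C \<Longrightarrow> y \<in> V \<Longrightarrow>
      {x, y} \<in> H \<Longrightarrow> Q (insert y C) (H - {{x, y}}) \<Longrightarrow> Q C (H - {{x, y}}) \<Longrightarrow> Q C H"
  shows "Q C H"
  using assms(1-3)
proof (induction "(C, H)" arbitrary: C H
    rule: wf_induct[OF wf_measures[of "[\<lambda>(C, H). n - card C, \<lambda>(C, H). card (edge_boundary H C)]"]])
  case 1
  note IH = 1(1) and C = 1(2) "1"(3) "1"(4)
  show ?case
  proof (cases "n \<le> card C \<or> edge_boundary H C = {}")
    case True
    then show ?thesis using big isolated C by (meson not_le)
  next
    case False
    then obtain x y where xy: "x \<in> C" "y \<notin> C" "{x, y} \<in> H"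
      by (auto simp: edge_boundary_def)
    then have y: "y \<in> V" using edge_in_V C by blast
    have fin: "finite (edge_boundary H C)"
    proof (rule finite_subset)
      show "edge_boundary H C \<subseteq> (\<Union>x\<in>C. {e \<in> E. x \<in> e})"
        using C by (auto simp: edge_boundary_def)
      show "finite (\<Union>x\<in>C. {e \<in> E. x \<in> e})"
        using C locally_finite by (auto simp: locally_finite_graph_def)
    qed
    have "edge_boundary (H - {{x, y}}) C \<subset> edge_boundary H C"
      using xy by (auto simp: edge_boundary_def)
    then have "card (edge_boundary (H - {{x, y}}) C) < card (edge_boundary H C)"
      by (rule psubset_card_mono[OF fin])
    then have "Q C (H - {{x, y}})"
      using C by (intro IH[rule_format, OF _ refl]) auto
    moreover have "Q (insert y C) (H - {{x, y}})"
      using C False xy y by (intro IH[rule_format, OF _ refl]) auto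
    ultimately show ?thesis using reveal C xy y by blast
  qed
qed

lemma prob_reach_reveal:
  assumes "C \<subseteq> V" "H \<subseteq> E" "x \<in> C" "y \<in> V" "{x, y} \<in> H" "p \<in> {0..1}"
  shows prob_size_below_reveal: "\<P>(\<omega> in bond_percolation E p. size_below n (reach H C \<omega>)) =
      p * \<P>(\<omega> in bond_percolation E p. size_below n (reach (H - {{x, y}}) (insert y C) \<omega>))
      + (1 - p) * \<P>(\<omega> in bond_percolation E p. size_below n (reach (H - {{x, y}}) C \<omega>))"
    and prob_finite_reveal: "\<P>(\<omega> in bond_percolation E p. finite (reach H C \<omega>)) =
      p * \<P>(\<omega> in bond_percolation E p. finite (reach (H - {{x, y}}) (insert y C) \<omega>))
      + (1 - p) * \<P>(\<omega> in bond_percolation E p. finite (reach (H - {{x, y}}) C \<omega>))"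
proof -
  have [simp]: "C \<subseteq> V" "H \<subseteq> E" "insert y C \<subseteq> V" "H - {{x, y}} \<subseteq> E" "{x, y} \<in> E"
    using assms by auto
  show "\<P>(\<omega> in bond_percolation E p. size_below n (reach H C \<omega>)) =
      p * \<P>(\<omega> in bond_percolation E p. size_below n (reach (H - {{x, y}}) (insert y C) \<omega>))
      + (1 - p) * \<P>(\<omega> in bond_percolation E p. size_below n (reach (H - {{x, y}}) C \<omega>))"
    by (rule prob_reveal_edge[where e = "{x, y}"])
      (use assms in \<open>simp_all add: measurable_size_below reach_blind reach_open_edge flip: reach_closed_edge\<close>)
  show "\<P>(\<omega> in bond_percolation E p. finite (reach H C \<omega>)) =
      p * \<P>(\<omega> in bond_percolation E p. finite (reach (H - {{x, y}}) (insert y C) \<omega>))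
      + (1 - p) * \<P>(\<omega> in bond_percolation E p. finite (reach (H - {{x, y}}) C \<omega>))"
    by (rule prob_reveal_edge[where e = "{x, y}"])
      (use assms in \<open>simp_all add: measurable_finite_reach reach_blind reach_open_edge flip: reach_closed_edge\<close>)
qed

lemma prob_finite_reach_antimono:
  assumes "C' \<subseteq> V" "H' \<subseteq> E" "C \<subseteq> C'" "H \<subseteq> H'"
  shows "\<P>(\<omega> in bond_percolation E p. finite (reach H' C' \<omega>))
    \<le> \<P>(\<omega> in bond_percolation E p. finite (reach H C \<omega>))"
proof -
  interpret prob_space "bond_percolation E p" by (rule prob_space_bond_percolation)
  have "C \<subseteq> V" "H \<subseteq> E" using assms by auto
  from measurable_finite_reach[OF this, of p] show ?thesis
    by (intro finite_measure_mono)
      (use reach_mono[OF assms(4,3)] in \<open>auto simp: pred_def intro: finite_subset\<close>)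
qed

lemma prob_size_below_antimono:
  assumes "C' \<subseteq> V" "H' \<subseteq> E" "C \<subseteq> C'" "H \<subseteq> H'"
  shows "\<P>(\<omega> in bond_percolation E p. size_below n (reach H' C' \<omega>))
    \<le> \<P>(\<omega> in bond_percolation E p. size_below n (reach H C \<omega>))"
proof -
  interpret prob_space "bond_percolation E p" by (rule prob_space_bond_percolation)
  have "size_below n A" if "size_below n B" "A \<subseteq> B" for A B :: "'a set"
    using that card_mono[of B A] finite_subset[of A B] by (auto simp: size_below_def)
  moreover have "C \<subseteq> V" "H \<subseteq> E" using assms by auto
  ultimately show ?thesis
    by (intro finite_measure_mono)
      (use reach_mono[OF assms(4,3)] measurable_size_below[of C H, where p = p and n = n] in \<open>auto simp: pred_def\<close>)
qed

section \<open>Automorphisms\<close>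

text \<open>The set explored from \<open>f ` C\<close> evolves as the image of the set explored from \<open>C\<close>, with the same
  probabilities at each step.\<close>

lemma prob_size_below_automorphism:
  assumes f: "graph_automorphism V E f" and p: "p \<in> {0..1}"
    and "finite C" "C \<subseteq> V" "H \<subseteq> E"
  shows "\<P>(\<omega> in bond_percolation E p. size_below n (reach ((`) f ` H) (f ` C) \<omega>)) =
    \<P>(\<omega> in bond_percolation E p. size_below n (reach H C \<omega>))"
  using assms(3-5)
proof (induction C H rule: exploration_induct[where n = n])
  case (big C H)
  have inj: "inj_on f V" using f by (simp add: graph_automorphism_def bij_betw_def)
  have "card (f ` C) = card C" using inj big by (intro card_image) (rule inj_on_subset)
  then show ?case using big size_below_reach_imp
    by (metis (no_types, lifting) leD)
next
  case (isolated C H)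
  have inj: "inj_on f V" using f by (simp add: graph_automorphism_def bij_betw_def)
  have card: "card (f ` C) = card C" using inj isolated by (intro card_image) (rule inj_on_subset)
  have "edge_boundary ((`) f ` H) (f ` C) = {}"
  proof (rule equals0I)
    fix e assume "e \<in> edge_boundary ((`) f ` H) (f ` C)"
    then obtain h x y where h: "h \<in> H" "x \<in> C" "y \<notin> f ` C" "f ` h = {f x, y}"
      by (auto simp: edge_boundary_def)
    obtain a b where ab: "a \<in> V" "b \<in> V" "h = {a, b}"
      using h(1) isolated simple unfolding simple_graph_def by blast
    have "x \<in> V" using h isolated by auto
    have "\<exists>z. h = {x, z} \<and> f z = y"
      using h(4) ab inj \<open>x \<in> V\<close> by (auto simp: doubleton_eq_iff inj_on_eq_iff)
    then have "\<exists>z. z \<notin> C \<and> h = {x, z}" using h(3) by blast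
    then have "h \<in> edge_boundary H C" using h(1,2) by (auto simp: edge_boundary_def)
    then show False using isolated(5) by simp
  qed
  then show ?case using isolated card by (simp add: reach_isolated size_below_def)
next
  case (reveal C H x y)
  have inj: "inj_on f V" using f by (simp add: graph_automorphism_def bij_betw_def)
  have fV: "f ` V = V" using f by (simp add: graph_automorphism_def bij_betw_def)
  have fE: "(`) f ` H \<subseteq> E"
  proof
    fix e assume "e \<in> (`) f ` H"
    then obtain h where h: "h \<in> E" "e = f ` h" using reveal by auto
    then obtain a b where ab: "a \<in> V" "b \<in> V" "h = {a, b}"
      using simple unfolding simple_graph_def by blast
    then show "e \<in> E" using f h by (auto simp: graph_automorphism_def)
  qed
  have "(`) f ` (H - {{x, y}}) = (`) f ` H - (`) f ` {{x, y}}"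
  proof (rule inj_on_image_set_diff[where C = E])
    have "E \<subseteq> Pow V" using simple by (auto simp: simple_graph_def)
    then show "inj_on ((`) f) E" using inj_on_image_Pow[OF inj] by (rule inj_on_subset[rotated])
  qed (use reveal in auto)
  then have image: "(`) f ` (H - {{x, y}}) = (`) f ` H - {{f x, f y}}" by simp
  have "\<P>(\<omega> in bond_percolation E p. size_below n (reach ((`) f ` H) (f ` C) \<omega>)) =
    p * \<P>(\<omega> in bond_percolation E p. size_below n (reach ((`) f ` H - {{f x, f y}}) (insert (f y) (f ` C)) \<omega>))
      + (1 - p) * \<P>(\<omega> in bond_percolation E p. size_below n (reach ((`) f ` H - {{f x, f y}}) (f ` C) \<omega>))"
  proof (rule prob_size_below_reveal[OF _ fE _ _ _ p])
    have "f ` {x, y} \<in> (`) f ` H" using reveal by blast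
    then show "{f x, f y} \<in> (`) f ` H" by simp
  qed (use reveal fV in auto)
  also have "\<dots> = \<P>(\<omega> in bond_percolation E p. size_below n (reach H C \<omega>))"
    using reveal(7,8) prob_size_below_reveal[OF reveal(2-6) p, of n] by (simp add: image)
  finally show ?case .
qed

text \<open>This makes the cost of adding a vertex to the explored set the same for every vertex.\<close>

lemma prob_finite_cluster_transitive:
  assumes "vertex_transitive V E" "v \<in> V" "w \<in> V" "p \<in> {0..1}"
  shows "\<P>(\<omega> in bond_percolation E p. finite (reach E {w} \<omega>)) =
    \<P>(\<omega> in bond_percolation E p. finite (reach E {v} \<omega>))"
proof -
  obtain f where f: "graph_automorphism V E f" "f v = w"
    using assms unfolding vertex_transitive_def by blast
  have fV: "f ` V = V" using f by (simp add: graph_automorphism_def bij_betw_def)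
  have edge: "\<exists>u\<in>V. \<exists>v\<in>V. e = {u, v}" if "e \<in> E" for e
    using that simple unfolding simple_graph_def by blast
  have "(`) f ` E = E"
  proof
    show "(`) f ` E \<subseteq> E"
      using f edge by (fastforce simp: graph_automorphism_def)
    show "E \<subseteq> (`) f ` E"
    proof
      fix e assume e: "e \<in> E"
      then obtain a b where ab: "a \<in> V" "b \<in> V" "e = {a, b}" using edge by blast
      then obtain a' b' where ab': "a' \<in> V" "b' \<in> V" "a = f a'" "b = f b'" 
        using fV by (metis imageE)
      then have "{a', b'} \<in> E" using f e ab by (simp add: graph_automorphism_def)
      moreover have "e = f ` {a', b'}" using ab ab' by simp
      ultimately show "e \<in> (`) f ` E" by blast
    qed
  qed
  then have "\<P>(\<omega> in bond_percolation E p. size_below n (reach E {w} \<omega>)) =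
    \<P>(\<omega> in bond_percolation E p. size_below n (reach E {v} \<omega>))" for n
    using prob_size_below_automorphism[OF f(1) assms(4), of "{v}" E n] assms f by simp
  then show ?thesis
    using prob_size_below_tendsto[of "{v}" E p] prob_size_below_tendsto[of "{w}" E p] assms
    by (simp add: LIMSEQ_unique)
qed

section \<open>Comparing two parameters\<close>

text \<open>Explore from \<open>C\<close> until nothing more can be reached. What \<open>y\<close> reaches through the edges left over
  is contained in its full cluster, so it is finite with at least the probability for the
  full cluster, whatever the exploration has found. Conditioning on the explored set thus replaces
  the Harris inequality. The truncation at \<open>n\<close> turns this into an induction, in which both sides
  satisfy the same affine recursion.\<close>

lemma prob_finite_insert_ge_truncated:
  assumes p: "p \<in> {0..1}" and y: "y \<in> V"
    and "finite C" "C \<subseteq> V" "H \<subseteq> E"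
  shows "\<P>(\<omega> in bond_percolation E p. finite (reach E {y} \<omega>))
      * \<P>(\<omega> in bond_percolation E p. size_below n (reach H C \<omega>))
    \<le> \<P>(\<omega> in bond_percolation E p. finite (reach H (insert y C) \<omega>) \<and> size_below n (reach H C \<omega>))"
  using assms(3-5)
proof (induction C H rule: exploration_induct[where n = n])
  case (big C H)
  then have "\<not> size_below n (reach H C \<omega>)" for \<omega>
    using size_below_reach_imp by (metis leD)
  then show ?case by simp
next
  case (isolated C H)
  interpret prob_space "bond_percolation E p" by (rule prob_space_bond_percolation)
  have "reach H (insert y C) \<omega> = reach H {y} \<omega> \<union> C" for \<omega>
    using reach_Un[of H "{y}" C \<omega>] isolated by (simp add: reach_isolated)
  then show ?case
    using isolated y prob_finite_reach_antimono[of "{y}" E "{y}" H p]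
    by (simp add: reach_isolated size_below_def prob_space)
next
  case (reveal C H z w)
  let ?e = "{z, w}"
  have [simp]: "C \<subseteq> V" "insert w C \<subseteq> V" "insert y C \<subseteq> V" "insert w (insert y C) \<subseteq> V" "H \<subseteq> E"
    "H - {?e} \<subseteq> E" "?e \<in> E" "y \<in> V" "w \<in> V"
    using reveal y by auto
  have "\<P>(\<omega> in bond_percolation E p. finite (reach H (insert y C) \<omega>) \<and> size_below n (reach H C \<omega>)) =
     p * \<P>(\<omega> in bond_percolation E p. finite (reach (H - {?e}) (insert w (insert y C)) \<omega>)
        \<and> size_below n (reach (H - {?e}) (insert w C) \<omega>))
     + (1 - p) * \<P>(\<omega> in bond_percolation E p. finite (reach (H - {?e}) (insert y C) \<omega>)
        \<and> size_below n (reach (H - {?e}) C \<omega>))"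
  proof (rule prob_reveal_edge[where e = "?e"])
    fix \<omega> :: "'a set \<Rightarrow> bool"
    assume "\<omega> ?e"
    from reach_open_edge[of \<omega> z w, OF this reveal(6)] reveal(4)
    show "(finite (reach H (insert y C) \<omega>) \<and> size_below n (reach H C \<omega>)) \<longleftrightarrow>
      finite (reach (H - {?e}) (insert w (insert y C)) \<omega>)
        \<and> size_below n (reach (H - {?e}) (insert w C) \<omega>)" by simp
  next
    fix \<omega> :: "'a set \<Rightarrow> bool"
    assume "\<not> \<omega> ?e"
    then show "(finite (reach H (insert y C) \<omega>) \<and> size_below n (reach H C \<omega>)) \<longleftrightarrow>
      finite (reach (H - {?e}) (insert y C) \<omega>) \<and> size_below n (reach (H - {?e}) C \<omega>)"
      by (simp flip: reach_closed_edge)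
  qed (use p in \<open>simp_all add: reach_blind measurable_size_below measurable_finite_reach
      pred_intros_logic\<close>)
  also have "\<dots> \<ge> p * (\<P>(\<omega> in bond_percolation E p. finite (reach E {y} \<omega>))
        * \<P>(\<omega> in bond_percolation E p. size_below n (reach (H - {?e}) (insert w C) \<omega>)))
     + (1 - p) * (\<P>(\<omega> in bond_percolation E p. finite (reach E {y} \<omega>))
        * \<P>(\<omega> in bond_percolation E p. size_below n (reach (H - {?e}) C \<omega>)))"
    using reveal(7)[unfolded insert_commute[of y w C]] reveal(8) p
    by (intro add_mono mult_left_mono) auto
  finally show ?case
    by (simp add: prob_size_below_reveal[OF reveal(2-6) p, of n] algebra_simps)
qed

lemma prob_finite_insert_ge:
  assumes p: "p \<in> {0..1}" and y: "y \<in> V"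
    and "finite C" "C \<subseteq> V" "H \<subseteq> E"
  shows "\<P>(\<omega> in bond_percolation E p. finite (reach E {y} \<omega>))
      * \<P>(\<omega> in bond_percolation E p. finite (reach H C \<omega>))
    \<le> \<P>(\<omega> in bond_percolation E p. finite (reach H (insert y C) \<omega>))"
proof (rule LIMSEQ_le_const2)
  interpret prob_space "bond_percolation E p" by (rule prob_space_bond_percolation)
  show "(\<lambda>n. \<P>(\<omega> in bond_percolation E p. finite (reach E {y} \<omega>))
      * \<P>(\<omega> in bond_percolation E p. size_below n (reach H C \<omega>)))
    \<longlonglongrightarrow> \<P>(\<omega> in bond_percolation E p. finite (reach E {y} \<omega>))
      * \<P>(\<omega> in bond_percolation E p. finite (reach H C \<omega>))"
    by (intro tendsto_mult_left prob_size_below_tendsto assms)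
  have "\<P>(\<omega> in bond_percolation E p. finite (reach H (insert y C) \<omega>) \<and> size_below n (reach H C \<omega>))
    \<le> \<P>(\<omega> in bond_percolation E p. finite (reach H (insert y C) \<omega>))" for n
    using measurable_finite_reach[of "insert y C" H p] assms
    by (intro finite_measure_mono) (auto simp: pred_def)
  then show "\<exists>N. \<forall>n\<ge>N. \<P>(\<omega> in bond_percolation E p. finite (reach E {y} \<omega>))
      * \<P>(\<omega> in bond_percolation E p. size_below n (reach H C \<omega>))
    \<le> \<P>(\<omega> in bond_percolation E p. finite (reach H (insert y C) \<omega>))"
    using prob_finite_insert_ge_truncated[OF assms] order_trans by blast
qed

text \<open>The domination described at the beginning: divided by the probability that the reached set is
  finite, the claim says that under the conditional measure this set is at most as likely to be
  small as under parameter \<open>q\<close>. The product form avoids division by zero.\<close>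

lemma size_below_comparison:
  assumes p: "p \<in> {0..1}" and q: "q \<in> {0..1}"
    and q_le: "\<And>y. y \<in> V \<Longrightarrow> q \<le> p * \<P>(\<omega> in bond_percolation E p. finite (reach E {y} \<omega>))"
    and "finite C" "C \<subseteq> V" "H \<subseteq> E"
  shows "\<P>(\<omega> in bond_percolation E p. size_below n (reach H C \<omega>))
    \<le> \<P>(\<omega> in bond_percolation E q. size_below n (reach H C \<omega>))
      * \<P>(\<omega> in bond_percolation E p. finite (reach H C \<omega>))"
  using assms(4-6)
proof (induction C H rule: exploration_induct[where n = n])
  case (big C H)
  then have "\<not> size_below n (reach H C \<omega>)" for \<omega>
    using size_below_reach_imp by (metis leD)
  then show ?case by simp
next
  case (isolated C H)
  interpret P: prob_space "bond_percolation E p" by (rule prob_space_bond_percolation)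
  interpret Q: prob_space "bond_percolation E q" by (rule prob_space_bond_percolation)
  show ?case
    using isolated by (simp add: reach_isolated size_below_def P.prob_space Q.prob_space)
next
  case (reveal C H x y)
  let ?H = "H - {{x, y}}"
  define s1 s0 t1 t0 h1 h0 \<phi> where
    "s1 = \<P>(\<omega> in bond_percolation E p. size_below n (reach ?H (insert y C) \<omega>))"
    "s0 = \<P>(\<omega> in bond_percolation E p. size_below n (reach ?H C \<omega>))"
    "t1 = \<P>(\<omega> in bond_percolation E q. size_below n (reach ?H (insert y C) \<omega>))"
    "t0 = \<P>(\<omega> in bond_percolation E q. size_below n (reach ?H C \<omega>))"
    "h1 = \<P>(\<omega> in bond_percolation E p. finite (reach ?H (insert y C) \<omega>))"
    "h0 = \<P>(\<omega> in bond_percolation E p. finite (reach ?H C \<omega>))"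
    "\<phi> = \<P>(\<omega> in bond_percolation E p. finite (reach E {y} \<omega>))"
  note defs = this
  \<comment> \<open>The subscripts 1 and 0 stand for the edge found open and found closed.\<close>
  have IH: "s1 \<le> t1 * h1" "s0 \<le> t0 * h0" using reveal(7,8) by (simp_all add: defs)
  have t: "t1 \<le> t0" unfolding defs
    using reveal by (intro prob_size_below_antimono) auto
  have h: "h1 \<le> h0" unfolding defs
    using reveal by (intro prob_finite_reach_antimono) auto
  have ins: "\<phi> * h0 \<le> h1" unfolding defs
    using reveal by (intro prob_finite_insert_ge p) auto
  have "h0 \<ge> 0" by (simp add: defs)
  have "p * h1 + (1 - p) * h0 \<le> h0"
    using mult_left_mono[OF h, of p] p by (simp add: algebra_simps)
  then have "q * (p * h1 + (1 - p) * h0) \<le> q * h0"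
    using q by (intro mult_left_mono) auto
  also have "\<dots> \<le> p * \<phi> * h0"
    using q_le[OF reveal(5)] \<open>h0 \<ge> 0\<close> by (intro mult_right_mono) (auto simp: defs)
  also have "\<dots> \<le> p * h1"
    using mult_left_mono[OF ins, of p] p by (simp add: mult.assoc)
  \<comment> \<open>An open edge is at least as likely under the conditional measure as under \<open>q\<close>, and it makes
    a small set less likely.\<close>
  finally have gap: "0 \<le> (t0 - t1) * (p * h1 - q * (p * h1 + (1 - p) * h0))"
    using t by simp
  have "p * s1 + (1 - p) * s0 \<le> p * (t1 * h1) + (1 - p) * (t0 * h0)"
    using IH p by (intro add_mono mult_left_mono) auto
  also have "\<dots> \<le> (q * t1 + (1 - q) * t0) * (p * h1 + (1 - p) * h0)"
    using gap by (simp add: algebra_simps)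
  finally show ?case
    using prob_size_below_reveal[OF reveal(2-6) p, of n] prob_size_below_reveal[OF reveal(2-6) q, of n]
      prob_finite_reveal[OF reveal(2-6) p]
    by (simp add: defs)
qed

lemma percolation_prob_eq:
  assumes "v \<in> V"
  shows "percolation_prob E v p = 1 - \<P>(\<omega> in bond_percolation E p. finite (reach E {v} \<omega>))"
proof -
  interpret prob_space "bond_percolation E p" by (rule prob_space_bond_percolation)
  show ?thesis
    unfolding percolation_prob_def cluster_eq_reach
    by (rule prob_neg) (use measurable_finite_reach[of "{v}" E p] assms in \<open>auto simp: pred_def\<close>)
qed

text \<open>In the limit \<open>n \<rightarrow> \<infinity>\<close> the comparison reads \<open>h \<le> t h\<close>, where \<open>h = 1 - \<theta>(p)\<close> and
  \<open>t = 1 - \<theta>(q)\<close>; as \<open>h > 0\<close>, this forces \<open>t = 1\<close>.\<close>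

lemma percolation_prob_eq_0:
  assumes "vertex_transitive V E" "v \<in> V" "p \<in> {0..1}" "q \<in> {0..1}"
    and q: "q \<le> p * (1 - percolation_prob E v p)" and pos: "percolation_prob E v p < 1"
  shows "percolation_prob E v q = 0"
proof -
  interpret Q: prob_space "bond_percolation E q" by (rule prob_space_bond_percolation)
  let ?h = "\<P>(\<omega> in bond_percolation E p. finite (reach E {v} \<omega>))"
  let ?t = "\<P>(\<omega> in bond_percolation E q. finite (reach E {v} \<omega>))"
  have h: "?h > 0" and q': "q \<le> p * ?h"
    using pos q assms(2) by (simp_all add: percolation_prob_eq)
  have "?h \<le> ?t * ?h"
  proof (rule LIMSEQ_le)
    show "(\<lambda>n. \<P>(\<omega> in bond_percolation E p. size_below n (reach E {v} \<omega>))) \<longlonglongrightarrow> ?h"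
      using assms(2) by (intro prob_size_below_tendsto) auto
    show "(\<lambda>n. \<P>(\<omega> in bond_percolation E q. size_below n (reach E {v} \<omega>)) * ?h) \<longlonglongrightarrow> ?t * ?h"
      using assms(2) by (intro tendsto_mult_right prob_size_below_tendsto) auto
    have "q \<le> p * \<P>(\<omega> in bond_percolation E p. finite (reach E {y} \<omega>))" if "y \<in> V" for y
      using q' prob_finite_cluster_transitive[OF assms(1,2) that assms(3)] by simp
    then show "\<exists>N. \<forall>n\<ge>N. \<P>(\<omega> in bond_percolation E p. size_below n (reach E {v} \<omega>))
        \<le> \<P>(\<omega> in bond_percolation E q. size_below n (reach E {v} \<omega>)) * ?h"
      using assms(2) by (intro exI allI impI size_below_comparison[OF assms(3,4)]) auto
  qed
  with h have "?t \<ge> 1" by simp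
  with Q.prob_le_1 have "?t = 1" by (metis order_antisym)
  then show ?thesis using assms(2) by (simp add: percolation_prob_eq)
qed

text \<open>So the set whose infimum is the critical probability is nonempty.\<close>

lemma percolation_prob_1:
  assumes "connected_graph V E" "infinite V" "v \<in> V"
  shows "percolation_prob E v 1 = 1"
proof -
  let ?M = "bond_percolation E 1"
  interpret prob_space ?M by (rule prob_space_bond_percolation)
  have supp: "set_pmf (bernoulli_pmf 1) = {True}"
  proof (rule set_eqI)
    show "b \<in> set_pmf (bernoulli_pmf 1) \<longleftrightarrow> b \<in> {True}" for b
      by (cases b) (simp_all add: set_pmf_iff)
  qed
  have "AE \<omega> in ?M. \<forall>e\<in>E. \<omega> e"
  proof (subst AE_ball_countable[OF countable_E], intro ballI)
    fix e assume "e \<in> E"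
    then show "AE \<omega> in ?M. \<omega> e"
      unfolding bond_percolation_def
      by (intro AE_PiM_component prob_space_measure_pmf) (simp_all add: AE_measure_pmf_iff supp)
  qed
  moreover have "infinite (reach E {v} \<omega>)" if "\<forall>e\<in>E. \<omega> e" for \<omega>
  proof -
    have "open_edges E \<omega> = E" using that by (auto simp: open_edges_def)
    then have "V \<subseteq> reach E {v} \<omega>"
      using assms(1,3) by (auto simp: reach_def connected_graph_def joined_by_def)
    then show ?thesis using assms(2) finite_subset by blast
  qed
  ultimately have "AE \<omega> in ?M. infinite (reach E {v} \<omega>)" by (rule eventually_mono)
  then have "\<P>(\<omega> in ?M. infinite (reach E {v} \<omega>)) = 1"
    by (subst prob_Collect_eq_1)
      (use measurable_finite_reach[of "{v}" E 1] assms in \<open>auto intro!: sets.sets_Collect_neg simp: pred_def\<close>)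
  then show ?thesis by (simp add: percolation_prob_def cluster_eq_reach)
qed

end

theorem theorem3:
  fixes V :: "'a set" and E :: "'a set set" and v\<^sub>0 :: 'a and p :: real
  assumes "simple_graph V E"
    and "connected_graph V E"
    and "locally_finite_graph V E"
    and "vertex_transitive V E"
    and "countable V" and "infinite V"
    and "v\<^sub>0 \<in> V"
    and "p \<in> {0..1}"
    and "p \<ge> critical_prob E v\<^sub>0"
  shows "percolation_prob E v\<^sub>0 p \<ge> (p - critical_prob E v\<^sub>0) / p"
proof (rule ccontr)
  let ?S = "{q \<in> {0..1}. percolation_prob E v\<^sub>0 q > 0}"
  interpret percolation_graph V E by unfold_locales (use assms in auto)
  assume less: "\<not> ?thesis"
  \<comment> \<open>For \<open>p = 0\<close> the quotient is \<open>0\<close> by convention.\<close>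
  have "p \<noteq> 0"
    using less by (auto simp: percolation_prob_def)
  then have "p > 0" using assms(8) by simp
  then have "critical_prob E v\<^sub>0 < p * (1 - percolation_prob E v\<^sub>0 p)"
    using less by (simp add: field_simps)
  moreover have "1 \<in> ?S"
    using percolation_prob_1[OF assms(2,6,7)] by simp
  ultimately obtain q where q: "q \<in> ?S" "q < p * (1 - percolation_prob E v\<^sub>0 p)"
    unfolding critical_prob_def by (metis (no_types, lifting) cInf_lessD empty_iff)
  then have "0 < p * (1 - percolation_prob E v\<^sub>0 p)" by auto
  then have "percolation_prob E v\<^sub>0 p < 1"
    using \<open>p > 0\<close> by (simp add: zero_less_mult_iff)
  then have "percolation_prob E v\<^sub>0 q = 0"
    using percolation_prob_eq_0[OF assms(4,7,8), of q] q by auto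
  with q show False by simp
qed

end
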